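(* Let $s,t,n$ be positive integers. The number of lattice paths from $(0,0)$ to $(sn-1,tn-1)$ lying weakly beneath $\mathsf{U}^{t-1}(\mathsf{R}^s\mathsf{U}^t)^{n-1}\mathsf{R}^{s-1}$ is $$\frac{1}{n}\binom{(s+t)n-2}{tn-1}.$$
   Context: Lattice paths use unit steps $(0,1)$ (up, $\mathsf{U}$) and $(1,0)$ (right, $\mathsf{R}$); a word in $\mathsf{U},\mathsf{R}$ describes a lattice path from $(0,0)$ (exponents denote repetition). A lattice path $P$ from $(0,0)$ lies weakly beneath the staircase path $S$ if $P$ has at most as many up steps as $S$ and, for each $r$, the $r$-th up step of $P$ has $x$-coordinate at least that of the $r$-th up step of $S$. *)

theory Defs
  imports Complex_Main
begin

datatype step = U | R

text \<open>A word over \<^typ>\<open>step\<close> is the lattice path that starts at the origin.\<close>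

definition end_point :: "step list \<Rightarrow> nat \<times> nat" where
  "end_point P = (count_list P R, count_list P U)"

definition word_power :: "step list \<Rightarrow> nat \<Rightarrow> step list" where
  "word_power w k = concat (replicate k w)"

text \<open>The x-coordinates of the successive up steps of a path whose starting point has
  x-coordinate \<open>x\<close>.\<close>

fun up_coords_from :: "nat \<Rightarrow> step list \<Rightarrow> nat list" where
  "up_coords_from x [] = []"
| "up_coords_from x (U # P) = x # up_coords_from x P"
| "up_coords_from x (R # P) = up_coords_from (x + 1) P"

text \<open>Up steps are numbered from 1.\<close>

definition up_coord :: "step list \<Rightarrow> nat \<Rightarrow> nat" where
  "up_coord P r = up_coords_from 0 P ! (r - 1)"

definition weakly_beneath :: "step list \<Rightarrow> step list \<Rightarrow> bool" where
  "weakly_beneath P S \<longleftrightarrow>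
     count_list P U \<le> count_list S U \<and>
     (\<forall>r\<in>{1..count_list P U}. up_coord P r \<ge> up_coord S r)"

definition staircase :: "nat \<Rightarrow> nat \<Rightarrow> nat \<Rightarrow> step list" where
  "staircase s t n =
     word_power [U] (t - 1)
     @ word_power (word_power [R] s @ word_power [U] t) (n - 1)
     @ word_power [R] (s - 1)"

end

theory Submission
  imports Defs
begin

text \<open>Record a path with \<open>t n - 1\<close> up steps by its \<open>t n\<close> horizontal gaps, i.e. the lengths of the
  runs of right steps before, between and after the up steps. The gaps are arbitrary natural numbers
  with sum \<open>s n - 1\<close>, so there are \<open>((s + t) n - 2) choose (t n - 1)\<close> paths altogether. Since the
  \<open>x\<close>-coordinates increase, lying beneath the staircase only constrains the up steps whose number is
  a multiple of \<open>t\<close>: cutting the gaps into \<open>n\<close> blocks of length \<open>t\<close> and subtracting \<open>s\<close> from each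
  block sum yields \<open>n\<close> integers with sum \<open>-1\<close>, and their proper partial sums have to be nonnegative.
  By the cycle lemma exactly one of the \<open>n\<close> cyclic rotations of the blocks has this property.\<close>

section \<open>Paths and their gap sequences\<close>

text \<open>The accumulator \<open>y\<close> holds the right steps already read in the current run.
  The final run is recorded even when it is empty, so a path with \<open>b\<close> up steps always
  has \<open>b + 1\<close> gaps.\<close>

fun gaps_from :: "nat \<Rightarrow> step list \<Rightarrow> nat list" where
  "gaps_from y [] = [y]"
| "gaps_from y (U # P) = y # gaps_from 0 P"
| "gaps_from y (R # P) = gaps_from (y + 1) P"

fun path_of_gaps :: "nat list \<Rightarrow> step list" where
  "path_of_gaps [] = []"
| "path_of_gaps [d] = replicate d R"
| "path_of_gaps (d # e # ds) = replicate d R @ U # path_of_gaps (e # ds)"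

lemma length_gaps_from: "length (gaps_from y P) = Suc (count_list P U)"
  by (induction y P rule: gaps_from.induct) auto

lemma sum_list_gaps_from: "sum_list (gaps_from y P) = y + count_list P R"
  by (induction y P rule: gaps_from.induct) auto

lemma gaps_from_replicate_R: "gaps_from y (replicate d R @ P) = gaps_from (y + d) P"
  by (induction d arbitrary: y) auto

lemma gaps_from_path_of_gaps: "ds \<noteq> [] \<Longrightarrow> gaps_from 0 (path_of_gaps ds) = ds"
proof (induction ds rule: path_of_gaps.induct)
  case (2 d)
  then show ?case using gaps_from_replicate_R[of 0 d "[]"] by simp
qed (auto simp: gaps_from_replicate_R)

lemma path_of_gaps_from: "path_of_gaps (gaps_from y P) = replicate y R @ P"
proof (induction y P rule: gaps_from.induct)
  case (2 y P)
  obtain e ds where "gaps_from 0 P = e # ds"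
    using length_gaps_from[of 0 P] by (cases "gaps_from 0 P") auto
  with 2 show ?case by simp
qed (auto simp: replicate_app_Cons_same)

lemma bij_betw_gaps_from:
  "bij_betw (gaps_from 0) {P. end_point P = (a, b)} {ds. length ds = Suc b \<and> sum_list ds = a}"
proof (rule bij_betw_byWitness[where f' = path_of_gaps])
  show "path_of_gaps ` {ds. length ds = Suc b \<and> sum_list ds = a} \<subseteq> {P. end_point P = (a, b)}"
  proof (clarsimp simp: end_point_def)
    fix ds :: "nat list"
    assume "length ds = Suc b"
    then have g: "gaps_from 0 (path_of_gaps ds) = ds" by (intro gaps_from_path_of_gaps) auto
    show "count_list (path_of_gaps ds) R = sum_list ds \<and> count_list (path_of_gaps ds) U = b"
      using sum_list_gaps_from[of 0 "path_of_gaps ds"] length_gaps_from[of 0 "path_of_gaps ds"]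
        \<open>length ds = Suc b\<close> g by simp
  qed
qed (auto simp: path_of_gaps_from length_gaps_from sum_list_gaps_from end_point_def
       intro!: gaps_from_path_of_gaps)

section \<open>The staircase condition in terms of gaps\<close>

text \<open>Here \<open>x\<close> is the coordinate at which the current run of right steps began
  and \<open>y\<close> is its length so far. Splitting the position into \<open>x + y\<close> lets
  the induction pass an up step, where the pair becomes \<open>x + y\<close> and
  \<open>0\<close>.\<close>

lemma nth_up_coords_from:
  "i < count_list P U \<Longrightarrow>
     up_coords_from (x + y) P ! i = x + sum_list (take (Suc i) (gaps_from y P))"
proof (induction y P arbitrary: x i rule: gaps_from.induct)
  case (2 y P)
  then show ?case using "2.IH"[of _ "x + y"] by (cases i) auto
next
  case (3 y P)
  then show ?case using "3.IH"[of i x] by simp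
qed simp

lemma up_coord_conv_gaps:
  assumes "1 \<le> r" and "r \<le> count_list P U"
  shows "up_coord P r = sum_list (take r (gaps_from 0 P))"
  using nth_up_coords_from[of "r - 1" P 0 0] assms by (simp add: up_coord_def)

lemma up_coords_from_append:
  "up_coords_from x (P @ Q) = up_coords_from x P @ up_coords_from (x + count_list P R) Q"
  by (induction x P rule: up_coords_from.induct) auto

lemma up_coords_from_replicate_U: "up_coords_from x (replicate k U) = replicate k x"
  by (induction k) auto

lemma up_coords_from_replicate_R: "up_coords_from x (replicate k R) = []"
  by (induction k arbitrary: x) auto

lemma count_list_replicate: "count_list (replicate k a) b = (if a = b then k else 0)"
  by (induction k) auto

lemma word_power_singleton: "word_power [a] k = replicate k a"
  by (induction k) (auto simp: word_power_def)

lemma word_power_Suc: "word_power w (Suc k) = w @ word_power w k"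
  by (simp add: word_power_def)

lemma count_list_word_power: "count_list (word_power w k) a = k * count_list w a"
  by (induction k) (auto simp: word_power_def)

lemma length_up_coords_from: "length (up_coords_from x P) = count_list P U"
  by (induction x P rule: up_coords_from.induct) auto

lemma nth_up_coords_from_word_power:
  assumes "i < t * m"
  shows "up_coords_from x (word_power (replicate s R @ replicate t U) m) ! i
         = x + s * Suc (i div t)"
  using assms
proof (induction m arbitrary: x i)
  case (Suc m)
  show ?case
  proof (cases "i < t")
    case True
    then show ?thesis
      by (simp add: word_power_Suc up_coords_from_append up_coords_from_replicate_U
          up_coords_from_replicate_R count_list_replicate nth_append)
  next
    case False
    moreover have "t > 0" using Suc.prems by (cases t) auto
    ultimately show ?thesis
      using Suc.IH[of "i - t" "x + s"] Suc.prems
      by (simp add: word_power_Suc up_coords_from_append up_coords_from_replicate_U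
          up_coords_from_replicate_R count_list_replicate nth_append le_div_geq)
  qed
qed simp

lemma count_list_staircase_U:
  assumes "t > 0" and "n > 0"
  shows "count_list (staircase s t n) U = t * n - 1"
  using assms
  by (cases n; cases t)
    (auto simp: staircase_def word_power_singleton count_list_word_power count_list_replicate)

text \<open>The first vertical run has \<open>t - 1\<close> steps instead of \<open>t\<close>, as if
  a step number 0 had been removed. Hence the jumps occur exactly at multiples of \<open>t\<close>,
  and the quotient is \<open>r div t\<close> rather than \<open>(r - 1) div t\<close>.\<close>

lemma up_coord_staircase:
  assumes "t > 0" and "n > 0" and "1 \<le> r" and "r < t * n"
  shows "up_coord (staircase s t n) r = s * (r div t)"
proof (cases "r < t")
  case True
  then have "r - 1 < t - 1" using assms by linarith
  then show ?thesis using assms True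
    by (simp add: up_coord_def staircase_def word_power_singleton up_coords_from_append
        up_coords_from_replicate_U nth_append)
next
  case False
  let ?w = "word_power (replicate s R @ replicate t U) (n - 1)"
  have lt: "r - t < t * (n - 1)" using assms False by (auto simp: algebra_simps)
  have "\<not> r - 1 < t - 1" using assms False by linarith
  \<comment> \<open>The list index \<open>r - 1\<close> drops by the \<open>t - 1\<close> initial up
    steps, which leaves \<open>r - t\<close>; the trailing right steps contribute no entry.\<close>
  then have "up_coord (staircase s t n) r = up_coords_from 0 ?w ! (r - t)"
    using assms False
    by (simp add: up_coord_def staircase_def word_power_singleton up_coords_from_append
        up_coords_from_replicate_U up_coords_from_replicate_R count_list_replicate nth_append
        length_up_coords_from count_list_word_power mult.commute)
  also have "\<dots> = s * Suc ((r - t) div t)"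
    using nth_up_coords_from_word_power[OF lt] by simp
  also have "\<dots> = s * (r div t)" using False assms by (simp add: le_div_geq)
  finally show ?thesis .
qed

lemma weakly_beneath_staircase_iff:
  assumes "t > 0" and "n > 0" and "count_list P U = t * n - 1"
  shows "weakly_beneath P (staircase s t n) \<longleftrightarrow>
         (\<forall>k<n. s * k \<le> sum_list (take (t * k) (gaps_from 0 P)))"
    (is "_ \<longleftrightarrow> ?blocks")
proof -
  have tn: "t * n > 0" using assms by simp
  have "weakly_beneath P (staircase s t n) \<longleftrightarrow>
        (\<forall>r\<in>{1..t * n - 1}. s * (r div t) \<le> sum_list (take r (gaps_from 0 P)))"
  proof -
    have "up_coord (staircase s t n) r = s * (r div t)"
      and "up_coord P r = sum_list (take r (gaps_from 0 P))" if "r \<in> {1..t * n - 1}" for r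
      using that assms tn by (auto intro!: up_coord_staircase up_coord_conv_gaps)
    then show ?thesis
      using assms by (simp add: weakly_beneath_def count_list_staircase_U)
  qed
  also have "\<dots> \<longleftrightarrow> ?blocks"
  proof safe
    fix k assume all: "\<forall>r\<in>{1..t * n - 1}. s * (r div t) \<le> sum_list (take r (gaps_from 0 P))"
      and "k < n"
    then have "t * k < t * n" using assms by simp
    show "s * k \<le> sum_list (take (t * k) (gaps_from 0 P))"
    \<comment> \<open>No up step has number 0, so this bound does not come from the path; it is
      trivially \<open>0 \<le> 0\<close>.\<close>
    proof (cases "k = 0")
      case False
      then have "t * k \<ge> 1" using assms by simp
      then have "t * k \<in> {1..t * n - 1}" using \<open>t * k < t * n\<close> unfolding atLeastAtMost_iff by linarith
      from bspec[OF all this] show ?thesis using assms by simp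
    qed simp
  next
    fix r assume all: ?blocks and r: "r \<in> {1..t * n - 1}"
    have "r < n * t" using r tn by (auto simp: mult.commute)
    then have "r div t < n" by (rule less_mult_imp_div_less)
    then have "s * (r div t) \<le> sum_list (take (t * (r div t)) (gaps_from 0 P))"
      using all by blast
    also have "\<dots> \<le> sum_list (take r (gaps_from 0 P))"
    proof -
      \<comment> \<open>The \<open>r mod t\<close> gaps after the last complete block can only
        increase the sum.\<close>
      have "take r (gaps_from 0 P) = take (t * (r div t) + r mod t) (gaps_from 0 P)" by simp
      then show ?thesis by (simp only: take_add sum_list_append)
    qed
    finally show "s * (r div t) \<le> sum_list (take r (gaps_from 0 P))" .
  qed
  finally show ?thesis .
qed

section \<open>The cycle lemma and counting by rotation\<close>

text \<open>The distinguished rotation starts at the first minimum of \<open>F\<close> on \<open>{0..<n}\<close>.\<close>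

lemma cycle_lemma:
  fixes F :: "nat \<Rightarrow> int"
  assumes "n > 0" and period: "\<And>j. F (j + n) = F j - 1"
  shows "\<exists>!k. k < n \<and> (\<forall>i<n. F k \<le> F (k + i))"
proof -
  \<comment> \<open>The window from \<open>k\<close> to \<open>k + n - 1\<close> meets every residue
    once. An index \<open>j < k\<close> occurs there as \<open>j + n\<close>, where \<open>F\<close>
    is lower by 1; over the integers \<open>F k \<le> F j - 1\<close> is the strict
    inequality.\<close>
  have iff: "(\<forall>i<n. F k \<le> F (k + i)) \<longleftrightarrow> (\<forall>j<n. F k \<le> F j \<and> (j < k \<longrightarrow> F k < F j))"
    if "k < n" for k
  proof safe
    fix j assume all: "\<forall>i<n. F k \<le> F (k + i)" and "j < n"
    show lt: "F k < F j" if "j < k"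
    proof -
      have "F k \<le> F (k + (j + n - k))" using all that \<open>k < n\<close> by (intro all[rule_format]) linarith
      then show ?thesis using that \<open>k < n\<close> period[of j] by simp
    qed
    show "F k \<le> F j"
    proof (cases "j < k")
      case False
      then show ?thesis using all[rule_format, of "j - k"] \<open>j < n\<close> by simp
    qed (use lt in simp)
  next
    fix i assume all: "\<forall>j<n. F k \<le> F j \<and> (j < k \<longrightarrow> F k < F j)" and "i < n"
    show "F k \<le> F (k + i)"
    proof (cases "k + i < n")
      case False
      then show ?thesis
        using all[rule_format, of "k + i - n"] \<open>i < n\<close> that period[of "k + i - n"] by simp
    qed (use all in blast)
  qed
  define m where "m = Min (F ` {..<n})"
  have m_le: "m \<le> F j" if "j < n" for j using that by (simp add: m_def)
  have "m \<in> F ` {..<n}" unfolding m_def using \<open>n > 0\<close> by (intro Min_in) auto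
  then have ex: "\<exists>k. k < n \<and> F k = m" by auto
  define k where "k = (LEAST k. k < n \<and> F k = m)"
  have k: "k < n" "F k = m" unfolding k_def using LeastI_ex[OF ex] by auto
  have "F k < F j" if "j < k" for j
    using not_less_Least[of j "\<lambda>k. k < n \<and> F k = m"] that k m_le[of j]
    unfolding k_def[symmetric] by force
  with k m_le have first: "k < n" "\<forall>j<n. F k \<le> F j \<and> (j < k \<longrightarrow> F k < F j)" by auto
  show ?thesis
  proof (rule ex1I[of _ k])
    show "k < n \<and> (\<forall>i<n. F k \<le> F (k + i))" using first iff by blast
  next
    fix k' assume k': "k' < n \<and> (\<forall>i<n. F k' \<le> F (k' + i))"
    then have "\<forall>j<n. F k' \<le> F j \<and> (j < k' \<longrightarrow> F k' < F j)" using iff by blast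
    \<comment> \<open>Of two distinct candidates, the later would have a strictly smaller value than
      the earlier, whose value is nevertheless minimal.\<close>
    with first k' have "\<not> k' < k" "\<not> k < k'" by (auto simp: not_less[symmetric])
    then show "k' = k" by simp
  qed
qed

lemma sum_list_take_rotate:
  fixes xs :: "nat list"
  assumes "r \<le> length xs"
  shows "(\<Sum>i<m + r. xs ! (i mod length xs))
         = (\<Sum>i<m. xs ! (i mod length xs)) + sum_list (take r (rotate m xs))"
proof -
  have "sum_list (take r (rotate m xs)) = (\<Sum>i<r. xs ! ((m + i) mod length xs))"
    using assms by (auto simp: sum_list_sum_nth atLeast0LessThan nth_rotate intro!: sum.cong)
  moreover have "(\<Sum>i<m + r. f i) = (\<Sum>i<m. f i) + (\<Sum>i<r. f (m + i))" for f :: "nat \<Rightarrow> nat"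
    by (induction r) auto
  ultimately show ?thesis by simp
qed

lemma sum_list_rotate:
  fixes xs :: "'a::comm_monoid_add list"
  shows "sum_list (rotate m xs) = sum_list xs"
proof -
  have "sum_list (rotate1 ys) = sum_list ys" for ys :: "'a list"
    by (cases ys) (simp_all add: add.commute)
  then show ?thesis by (induction m) simp_all
qed

lemma ex1_rotation:
  fixes ds :: "nat list"
  assumes "s > 0" and "n > 0"
    and len: "length ds = t * n" and total: "sum_list ds = s * n - 1"
  shows "\<exists>!k. k < n \<and> (\<forall>i<n. s * i \<le> sum_list (take (t * i) (rotate (t * k) ds)))"
proof -
  define A where "A m = (\<Sum>i<m. ds ! (i mod length ds))" for m
  \<comment> \<open>\<open>A\<close> gives prefix sums of the periodic extension of
    \<open>ds\<close>, and \<open>F\<close> subtracts \<open>s\<close> per block. A full turn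
    changes \<open>F\<close> by \<open>(s * n - 1) - s * n = -1\<close>, as
    \<open>cycle_lemma\<close> requires.\<close>
  define F where "F j = int (A (t * j)) - int (s * j)" for j
  have A: "A (m + r) = A m + sum_list (take r (rotate m ds))" if "r \<le> t * n" for m r
    unfolding A_def using sum_list_take_rotate that len by metis
  have "F (j + n) = F j - 1" for j
  proof -
    have "sum_list (rotate (t * j) ds) = sum_list ds"
      by (rule sum_list_rotate)
    then have "A (t * j + t * n) = A (t * j) + (s * n - 1)"
      using A[of "t * n" "t * j"] len total by simp
    moreover have "s * n \<ge> 1" using assms by simp
    ultimately have "int (A (t * (j + n))) = int (A (t * j)) + int (s * n) - 1"
      unfolding distrib_left by linarith
    then show ?thesis by (simp add: F_def distrib_left)
  qed
  then have "\<exists>!k. k < n \<and> (\<forall>i<n. F k \<le> F (k + i))" using cycle_lemma \<open>n > 0\<close> by blast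
  moreover have "F k \<le> F (k + i) \<longleftrightarrow> s * i \<le> sum_list (take (t * i) (rotate (t * k) ds))"
    if "i < n" for k i
  proof -
    have "A (t * k + t * i) = A (t * k) + sum_list (take (t * i) (rotate (t * k) ds))"
      using that by (intro A) simp
    then have "F (k + i) - F k = int (sum_list (take (t * i) (rotate (t * k) ds))) - int (s * i)"
      by (simp add: F_def distrib_left)
    then show ?thesis by linarith
  qed
  ultimately show ?thesis by simp
qed

text \<open>Double counting of the pairs of a list and an index \<open>k < n\<close> whose rotation
  satisfies \<open>Q\<close>: each list lies in one pair, and each \<open>k\<close> in as many pairs
  as there are lists with \<open>Q\<close>. No orbits are formed, so lists with rotational symmetry
  need no separate treatment.\<close>

lemma card_eq_mult_card_rotation:
  fixes Q :: "'a list \<Rightarrow> bool"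
  assumes "finite L" and closed: "\<And>xs m. rotate m xs \<in> L \<longleftrightarrow> xs \<in> L"
    and unique: "\<And>xs. xs \<in> L \<Longrightarrow> \<exists>!k. k < n \<and> Q (rotate (t * k) xs)"
  shows "card L = n * card {xs \<in> L. Q xs}"
proof -
  have "card {k \<in> {..<n}. Q (rotate (t * k) xs)} = 1" if "xs \<in> L" for xs
  proof -
    have "\<exists>k. {k. k < n \<and> Q (rotate (t * k) xs)} = {k}"
      using unique[OF that] unfolding Ex1_def set_eq_iff mem_Collect_eq singleton_iff by metis
    then obtain k where "{k \<in> {..<n}. Q (rotate (t * k) xs)} = {k}" by auto
    then show ?thesis by simp
  qed
  then have "(\<Sum>k<n. card {xs \<in> L. Q (rotate (t * k) xs)}) = 1 * card L"
    using \<open>finite L\<close> by (intro sum_multicount) auto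
  moreover have "card {xs \<in> L. Q (rotate m xs)} = card {xs \<in> L. Q xs}" for m
  proof -
    have inj: "inj (rotate m :: 'a list \<Rightarrow> 'a list)"
      unfolding rotate_def by (rule inj_fn[OF inj_rotate1])
    \<comment> \<open>An injective map of a finite set into itself is onto.\<close>
    then have "rotate m ` L = L"
      using \<open>finite L\<close> closed by (intro card_subset_eq card_image) (auto intro: inj_on_subset)
    then have "{xs \<in> L. Q xs} = {xs \<in> rotate m ` L. Q xs}" by simp
    also have "\<dots> = rotate m ` {xs \<in> L. Q (rotate m xs)}" by blast
    finally have "rotate m ` {xs \<in> L. Q (rotate m xs)} = {xs \<in> L. Q xs}" by (rule sym)
    moreover have "inj_on (rotate m) {xs \<in> L. Q (rotate m xs)}"
      using inj by (rule inj_on_subset) simp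
    ultimately show ?thesis using card_image[of "rotate m"] by fastforce
  qed
  ultimately show ?thesis by simp
qed

theorem theorem5:
  fixes s t n :: nat
  assumes "s > 0" and "t > 0" and "n > 0"
  shows "real (card {P. end_point P = (s * n - 1, t * n - 1) \<and> weakly_beneath P (staircase s t n)})
       = 1 / real n * real (((s + t) * n - 2) choose (t * n - 1))"
proof -
  define L where "L = {ds::nat list. length ds = t * n \<and> sum_list ds = s * n - 1}"
  define Q where "Q ds \<longleftrightarrow> (\<forall>k<n. s * k \<le> sum_list (take (t * k) ds))" for ds :: "nat list"
  let ?paths = "{P. end_point P = (s * n - 1, t * n - 1)}"
  let ?beneath = "{P. end_point P = (s * n - 1, t * n - 1) \<and> weakly_beneath P (staircase s t n)}"
  have pos: "s * n \<ge> 1" "t * n \<ge> 1" using assms by simp_all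
  have sum_eq: "(s + t) * n - 2 = (s * n - 1) + (t * n - 1)"
    using pos by (simp add: distrib_right)
  \<comment> \<open>Stars and bars: \<open>t * n\<close> natural numbers with sum
    \<open>s * n - 1\<close>.\<close>
  have "card L = (s * n - 1 + (t * n - 1)) choose (s * n - 1)"
    using card_length_sum_list[of "t * n" "s * n - 1"] pos by (simp add: L_def)
  also have "\<dots> = (s * n - 1 + (t * n - 1)) choose (t * n - 1)"
    using binomial_symmetric[of "s * n - 1" "s * n - 1 + (t * n - 1)"] by simp
  finally have card_L: "card L = ((s + t) * n - 2) choose (t * n - 1)"
    by (simp only: sum_eq)
  have "finite L"
  proof (rule finite_subset)
    show "L \<subseteq> {ds. set ds \<subseteq> {..s * n - 1} \<and> length ds = t * n}"
    proof
      fix ds assume "ds \<in> L"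
      then show "ds \<in> {ds. set ds \<subseteq> {..s * n - 1} \<and> length ds = t * n}"
        using member_le_sum_list[of _ ds] by (auto simp: L_def simp del: One_nat_def)
    qed
  qed (simp add: finite_lists_length_eq)
  moreover have "rotate m ds \<in> L \<longleftrightarrow> ds \<in> L" for m ds
    by (simp add: L_def sum_list_rotate)
  moreover have "\<exists>!k. k < n \<and> Q (rotate (t * k) ds)" if "ds \<in> L" for ds
    unfolding Q_def using that assms by (intro ex1_rotation) (auto simp: L_def)
  ultimately have "card L = n * card {ds \<in> L. Q ds}" by (rule card_eq_mult_card_rotation)
  moreover have "card ?beneath = card {ds \<in> L. Q ds}"
  proof (rule bij_betw_same_card)
    have bij: "bij_betw (gaps_from 0) ?paths L"
      using bij_betw_gaps_from[of "s * n - 1" "t * n - 1"] pos by (simp add: L_def)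
    have "weakly_beneath P (staircase s t n) \<longleftrightarrow> Q (gaps_from 0 P)" if "P \<in> ?paths" for P
      unfolding Q_def using that assms
      by (intro weakly_beneath_staircase_iff) (auto simp: end_point_def)
    then have "gaps_from 0 ` ?beneath = {ds \<in> L. Q ds}"
      unfolding bij_betw_imp_surj_on[OF bij, symmetric] by blast
    then show "bij_betw (gaps_from 0) ?beneath {ds \<in> L. Q ds}"
      by (intro bij_betw_subset[OF bij]) auto
  qed
  ultimately show ?thesis using card_L assms by (simp add: field_simps flip: of_nat_mult)
qed

end
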